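(* Suppose $\mu\in E$ satisfies $\langle\mu,u\rangle\ge0$ for all $u\in\mathcal K$ with $Au=0$. Let $D_\mu=\{\lambda\in\mathbb R^m:\ \mu-A^*\lambda\in\mathcal K^*\}$. Then $\inf_{b\in\mathcal B}\sigma_{D_\mu}(b)\le\vartheta(\mu)$, and thus, for every real $\eta_0\le\inf_{b\in\mathcal B}\sigma_{D_\mu}(b)$, the inequality $\langle\mu,x\rangle\ge\eta_0$ is valid for $\mathcal S(A,\mathcal K,\mathcal B)$ (i.e. holds for all $x\in\mathcal S(A,\mathcal K,\mathcal B)$).
   Context: $E$ is a finite-dimensional Euclidean space with inner product $\langle\cdot,\cdot\rangle$; $\mathcal K\subset E$ is a regular cone (closed, convex, pointed, full-dimensional); $\mathcal K^*=\{y\in E:\langle x,y\rangle\ge0\ \forall x\in\mathcal K\}$ is its dual cone; $A:E\to\mathbb R^m$ is linear with conjugate map $A^*:\mathbb R^m\to E$ given by $y^TAx=\langle A^*y,x\rangle$; $\mathcal B\subseteq\mathbb R^m$ is an arbitrary nonempty set; $\mathcal S(A,\mathcal K,\mathcal B)=\{x\in\mathcal K: Ax\in\mathcal B\}$, assumed to satisfy $\mathcal S(A,\mathcal K,\mathcal B)\neq\emptyset$ and $\mathcal S(A,\mathcal K,\mathcal B)\ne\mathcal K$. $\vartheta(\mu)=\inf\{\langle\mu,x\rangle:x\in\mathcal S(A,\mathcal K,\mathcal B)\}\in[-\infty,\infty)$. The support function of $D\subseteq\mathbb R^m$ is $\sigma_D(z)=\sup\{z^T\lambda:\lambda\in D\}\in[-\infty,\infty]$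 (with $\sup\emptyset=-\infty$). *)

theory Defs
  imports "HOL-Analysis.Analysis"
begin

text \<open>Pointed means containing no line. The first four conditions alone admit the empty set;
  the dimension condition excludes it, as \<^term>\<open>aff_dim {} = -1\<close>.\<close>

definition regular_cone :: "'a::euclidean_space set \<Rightarrow> bool" where
  "regular_cone K \<longleftrightarrow>
     cone K \<and> closed K \<and> convex K \<and> K \<inter> uminus ` K \<subseteq> {0} \<and> aff_dim K = int DIM('a)"

definition dual_cone :: "'a::real_inner set \<Rightarrow> 'a set" where
  "dual_cone K = {y. \<forall>x\<in>K. x \<bullet> y \<ge> 0}"

definition disj_conic_set :: "('a \<Rightarrow> 'b) \<Rightarrow> 'a set \<Rightarrow> 'b set \<Rightarrow> 'a set" where
  "disj_conic_set A K B = {x \<in> K. A x \<in> B}"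

definition vartheta :: "('a::real_inner \<Rightarrow> 'b) \<Rightarrow> 'a set \<Rightarrow> 'b set \<Rightarrow> 'a \<Rightarrow> ereal" where
  "vartheta A K B \<mu> = (INF x\<in>disj_conic_set A K B. ereal (\<mu> \<bullet> x))"

definition support_function :: "'b::real_inner set \<Rightarrow> 'b \<Rightarrow> ereal" where
  "support_function D z = (SUP d\<in>D. ereal (z \<bullet> d))"

text \<open>\<^const>\<open>adjoint\<close> is given by a choice operator; it is the conjugate map only for linear
  \<open>A\<close>.\<close>

definition D_set ::
  "('a::euclidean_space \<Rightarrow> 'b::euclidean_space) \<Rightarrow> 'a set \<Rightarrow> 'a \<Rightarrow> 'b set" where
  "D_set A K \<mu> = {l. \<mu> - adjoint A l \<in> dual_cone K}"

end

theory Submission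
  imports Defs
begin

text \<open>This is weak conic duality. If \<open>x\<close> is in the cone and \<open>l\<close> is dual feasible, then
  \<open>0 \<le> x \<bullet> (\<mu> - A\<^sup>* l) = \<mu> \<bullet> x - A x \<bullet> l\<close>. Hence the support function of the
  dual feasible set at the single point \<open>A x\<close> is at most \<open>\<mu> \<bullet> x\<close>. When \<open>x\<close> ranges over the
  disjunctive conic set, \<open>A x\<close> is one of the competitors in the infimum over \<open>B\<close>, so that infimum
  is a lower bound for \<open>\<mu> \<bullet> x\<close> on the whole set. If no dual feasible point exists, the supremum
  is \<open>-\<infinity>\<close> and the bound is trivial.\<close>

lemma support_function_D_set_le_inner:
  fixes A :: "'a::euclidean_space \<Rightarrow> 'b::euclidean_space"
  assumes "linear A" and "x \<in> K"
  shows "support_function (D_set A K \<mu>) (A x) \<le> ereal (\<mu> \<bullet> x)"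
  unfolding support_function_def
proof (rule SUP_least)
  fix l
  assume "l \<in> D_set A K \<mu>"
  then have "0 \<le> x \<bullet> (\<mu> - adjoint A l)"
    using \<open>x \<in> K\<close> by (simp add: D_set_def dual_cone_def)
  also have "\<dots> = \<mu> \<bullet> x - A x \<bullet> l"
    using adjoint_works[OF \<open>linear A\<close>, of x l] by (simp add: inner_diff_right inner_commute)
  finally show "ereal (A x \<bullet> l) \<le> ereal (\<mu> \<bullet> x)"
    by simp
qed

theorem proposition4p1:
  fixes A :: "'a::euclidean_space \<Rightarrow> real ^ 'm"
    and K :: "'a set"
    and B :: "(real ^ 'm) set"
    and \<mu> :: 'a
  assumes "regular_cone K"
    and "linear A"
    and "B \<noteq> {}"
    and "disj_conic_set A K B \<noteq> {}"
    and "disj_conic_set A K B \<noteq> K"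
    and "\<forall>u\<in>K. A u = 0 \<longrightarrow> \<mu> \<bullet> u \<ge> 0"
  shows "(INF b\<in>B. support_function (D_set A K \<mu>) b) \<le> vartheta A K B \<mu> \<and>
    (\<forall>\<eta>0::real. ereal \<eta>0 \<le> (INF b\<in>B. support_function (D_set A K \<mu>) b) \<longrightarrow>
      (\<forall>x\<in>disj_conic_set A K B. \<mu> \<bullet> x \<ge> \<eta>0))"
proof -
  let ?I = "INF b\<in>B. support_function (D_set A K \<mu>) b"
  have bound: "?I \<le> ereal (\<mu> \<bullet> x)" if "x \<in> disj_conic_set A K B" for x
  proof -
    have "x \<in> K" and "A x \<in> B"
      using that by (auto simp: disj_conic_set_def)
    have "?I \<le> support_function (D_set A K \<mu>) (A x)"
      using \<open>A x \<in> B\<close> by (rule INF_lower)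
    also have "\<dots> \<le> ereal (\<mu> \<bullet> x)"
      using \<open>linear A\<close> \<open>x \<in> K\<close> by (rule support_function_D_set_le_inner)
    finally show ?thesis .
  qed
  then have "?I \<le> vartheta A K B \<mu>"
    unfolding vartheta_def by (rule INF_greatest)
  moreover have "\<eta>0 \<le> \<mu> \<bullet> x"
    if "ereal \<eta>0 \<le> ?I" and "x \<in> disj_conic_set A K B" for \<eta>0 x
    using order_trans[OF that(1) bound[OF that(2)]] by simp
  ultimately show ?thesis
    by blast
qed

end
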